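(* (1) The set of singletons statistic $\mathrm{Sg}$ is weakly shuffle-compatible on set partitions. (2) The linear map on $\mathcal{A}^{\Pi}_{\mathrm{Sg}}$ defined by $[\pi]^\Pi_{\mathrm{Sg}}\mapsto W_{bw(\mathrm{Sg}(\pi))}$ is an algebra isomorphism between $\mathcal{A}^{\Pi}_{\mathrm{Sg}}$ and the subalgebra of $\mathbb{Q}_{\mathrm{sh}}\langle0,1\rangle$ spanned by $\{W_u: u\in W(0,1),\ \sum_i u_i\ne|u|-1\}$.
   Context: All algebras are over $\mathbb{Q}$. $\Pi_n$ is the set of set partitions of $[n]=\{1,\dots,n\}$, and $\Pi=\bigcup_{n\ge0}\Pi_n$; $|\pi|=n$ for $\pi\in\Pi_n$. For $\pi$ a set partition of $\{i_1<\dots<i_n\}$ and $S=\{s_1<\dots<s_n\}$, $\mathrm{shift}_S(\pi)$ is the set partition of $S$ obtained by replacing each $i_j$ by $s_j$. For $\tau\in\Pi_n,\theta\in\Pi_m$, the shifted arc-shuffle is the multiset (indexed by $S$) $\overrightarrow{\mathrm{ASh}}(\tau,\theta)=\{\{\mathrm{shift}_S(\tau)\cup\mathrm{shift}_{[n+m]\setminus S}(\theta): S\subseteq[n+m],|S|=n\}\}$. The singleton set is $\mathrm{Sg}(\pi)=\{i:\{i\}\text{ is a block of }\pi\}$. A statistic $\mathrm{st}$ on $\Pi$ is weakly shuffle-compatible on set partitions if for all $\tau,\theta\in\Pi$ the multiset $\{\{\mathrm{st}(\pi):\pi\in\overrightarrow{\mathrm{ASh}}(\tau,\theta)\}\}$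 is determined by $\mathrm{st}(\tau),\mathrm{st}(\theta),|\tau|,|\theta|$. Let $[\pi]^\Pi_{\mathrm{st}}=\{\tau\in\Pi:\mathrm{st}(\tau)=\mathrm{st}(\pi),|\tau|=|\pi|\}$. $\mathcal{A}^\Pi_{\mathrm{st}}$ is the algebra with basis these classes and product $[\tau]^\Pi_{\mathrm{st}}[\theta]^\Pi_{\mathrm{st}}=\sum_{\pi\in\overrightarrow{\mathrm{ASh}}(\tau,\theta)}[\pi]^\Pi_{\mathrm{st}}$ (with multiplicity). $W(0,1)$ is the set of all finite words $u$ in the letters $0,1$ (including the empty word), $|u|$ is the length. $\mathbb{Q}_{\mathrm{sh}}\langle0,1\rangle$ is the shuffle algebra on binary words: basis $\{W_u\}_{u\in W(0,1)}$ and product $W_vW_w=\sum_uW_u$ over the multiset of all $\binom{|v|+|w|}{|v|}$ interleavings $u$ of $v$ and $w$. For $\pi\in\Pi_n$, $bw(\mathrm{Sg}(\pi))$ is the binary word of length $n$ whose $i$-th letter is $1$ if and only if $i\in\mathrm{Sg}(\pi)$. *)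

theory Defs
  imports
    "HOL-Algebra.Algebra"
    "HOL-Algebra.Algebraic_Closure_Type"
    "HOL-Library.Disjoint_Sets"
    "HOL-Library.Multiset"
    "HOL-Library.Poly_Mapping"
begin

section \<open>Rational algebras with a multiset-valued multiplication table\<close>

text \<open>All records below are modules in the sense of \<^theory>\<open>HOL-Algebra.Module\<close> over the
  ground field \<open>rat_field\<close>; the locale \<^locale>\<open>algebra\<close> of that theory is that of
  associative, commutative, unital algebras.\<close>

abbreviation rat_field :: "rat ring" where
  "rat_field \<equiv> ring_of_type_algebra"

definition pm_scale :: "rat \<Rightarrow> ('b \<Rightarrow>\<^sub>0 rat) \<Rightarrow> ('b \<Rightarrow>\<^sub>0 rat)" where
  "pm_scale c f = Poly_Mapping.map ((*) c) f"

abbreviation basis_vec :: "'b \<Rightarrow> ('b \<Rightarrow>\<^sub>0 rat)" where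
  "basis_vec b \<equiv> Poly_Mapping.single b 1"

text \<open>The space with basis \<open>B\<close>, the bilinear product given on basis elements by
  \<open>u * v = (\<Sum>w\<in>#m u v. w)\<close>, and the basis element \<open>e\<close> as the unit.\<close>

definition table_algebra ::
    "'b set \<Rightarrow> ('b \<Rightarrow> 'b \<Rightarrow> 'b multiset) \<Rightarrow> 'b \<Rightarrow> (rat, 'b \<Rightarrow>\<^sub>0 rat) module" where
  "table_algebra B m e =
    \<lparr>partial_object.carrier = {f. Poly_Mapping.keys f \<subseteq> B},
     monoid.mult = (\<lambda>f g. \<Sum>u\<in>Poly_Mapping.keys f. \<Sum>v\<in>Poly_Mapping.keys g.
       pm_scale (Poly_Mapping.lookup f u * Poly_Mapping.lookup g v)
         (\<Sum>w\<in>#m u v. basis_vec w)),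
     monoid.one = basis_vec e,
     ring.zero = 0,
     ring.add = (+),
     module.smult = pm_scale\<rparr>"

definition linear_maps ::
    "('r, 'm) ring_scheme \<Rightarrow> ('r, 'a, 'k) module_scheme \<Rightarrow> ('r, 'b, 'l) module_scheme
      \<Rightarrow> ('a \<Rightarrow> 'b) set" where
  "linear_maps R M N = {f \<in> carrier M \<rightarrow> carrier N.
     (\<forall>x\<in>carrier M. \<forall>y\<in>carrier M. f (x \<oplus>\<^bsub>M\<^esub> y) = f x \<oplus>\<^bsub>N\<^esub> f y) \<and>
     (\<forall>c\<in>carrier R. \<forall>x\<in>carrier M. f (c \<odot>\<^bsub>M\<^esub> x) = c \<odot>\<^bsub>N\<^esub> f x)}"

definition algebra_isos ::
    "('r, 'm) ring_scheme \<Rightarrow> ('r, 'a, 'k) module_scheme \<Rightarrow> ('r, 'b, 'l) module_scheme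
      \<Rightarrow> ('a \<Rightarrow> 'b) set" where
  "algebra_isos R A B = linear_maps R A B \<inter> ring_iso A B"


section \<open>Set partitions and the shifted arc-shuffle\<close>

definition set_partitions :: "nat set set set" where
  "set_partitions = {p. \<exists>n. partition_on {1..n} p}"

text \<open>\<open>|\<pi>|\<close>: the cardinality of the ground set, which is \<open>\<Union>\<pi>\<close>.\<close>

definition ground_size :: "nat set set \<Rightarrow> nat" where
  "ground_size p = card (\<Union>p)"

text \<open>An element \<open>i\<close> of the ground set is replaced by the element of \<open>S\<close> of the same rank.\<close>

definition shift :: "nat set \<Rightarrow> nat set set \<Rightarrow> nat set set" where
  "shift S p = (\<lambda>B. (\<lambda>i. sorted_list_of_set S ! card {j \<in> \<Union>p. j < i}) ` B) ` p"

definition arc_shuffle :: "nat set set \<Rightarrow> nat set set \<Rightarrow> nat set set multiset" where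
  "arc_shuffle t h =
     image_mset (\<lambda>S. shift S t \<union> shift ({1..ground_size t + ground_size h} - S) h)
       (mset_set {S. S \<subseteq> {1..ground_size t + ground_size h} \<and> card S = ground_size t})"

definition weakly_shuffle_compatible :: "(nat set set \<Rightarrow> 'a) \<Rightarrow> bool" where
  "weakly_shuffle_compatible st \<longleftrightarrow>
     (\<forall>t\<in>set_partitions. \<forall>h\<in>set_partitions. \<forall>t'\<in>set_partitions. \<forall>h'\<in>set_partitions.
        st t = st t' \<and> st h = st h' \<and> ground_size t = ground_size t' \<and> ground_size h = ground_size h' \<longrightarrow>
        image_mset st (arc_shuffle t h) = image_mset st (arc_shuffle t' h'))"

definition st_class :: "(nat set set \<Rightarrow> 'a) \<Rightarrow> nat set set \<Rightarrow> nat set set set" where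
  "st_class st p = {t \<in> set_partitions. st t = st p \<and> ground_size t = ground_size p}"

text \<open>The product of two classes is computed from chosen representatives; for a weakly
  shuffle-compatible statistic the choice is irrelevant, see \<open>class_algebra_mult\<close> below.
  The unit is the class of the empty partition, the only element of \<open>\<Pi>\<^sub>0\<close>.\<close>

definition class_shuffle ::
    "(nat set set \<Rightarrow> 'a) \<Rightarrow> nat set set set \<Rightarrow> nat set set set \<Rightarrow> nat set set set multiset" where
  "class_shuffle st C D =
     image_mset (st_class st) (arc_shuffle (SOME t. t \<in> C) (SOME h. h \<in> D))"

definition class_algebra ::
    "(nat set set \<Rightarrow> 'a) \<Rightarrow> (rat, nat set set set \<Rightarrow>\<^sub>0 rat) module" where
  "class_algebra st =
     table_algebra (st_class st ` set_partitions) (class_shuffle st) (st_class st {})"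

lemma ground_size_arc_shuffle:
  assumes t: "t \<in> set_partitions" and h: "h \<in> set_partitions" and p: "p \<in># arc_shuffle t h"
  shows "ground_size p = ground_size t + ground_size h"
proof -
  have shift_ground: "\<Union>(shift S q) = S"
    if q: "q \<in> set_partitions" and S: "finite S" "card S = ground_size q" for S q
  proof -
    obtain n where n: "\<Union>q = {1..n}"
      using q by (auto simp: set_partitions_def partition_on_def)
    have "{j \<in> \<Union>q. j < i} = {1..<i}" if "i \<in> {1..n}" for i
      using that n by auto
    then have "(\<lambda>i. card {j \<in> \<Union>q. j < i}) ` {1..n} = (\<lambda>i. i - 1) ` {1..n}"
      by (intro image_cong) auto
    also have "\<dots> = {..<n}"
    proof (intro equalityI subsetI)
      fix k assume "k \<in> {..<n}"
      then show "k \<in> (\<lambda>i. i - 1) ` {1..n}"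
        by (intro image_eqI[of _ _ "Suc k"]) auto
    qed auto
    finally have ranks: "(\<lambda>i. card {j \<in> \<Union>q. j < i}) ` \<Union>q = {..<n}"
      by (simp add: n)
    have len: "length (sorted_list_of_set S) = n"
      using S n by (simp add: ground_size_def)
    have "\<Union>(shift S q) = (!) (sorted_list_of_set S) ` (\<lambda>i. card {j \<in> \<Union>q. j < i}) ` \<Union>q"
      unfolding shift_def by blast
    also have "\<dots> = (!) (sorted_list_of_set S) ` {..<length (sorted_list_of_set S)}"
      by (simp only: ranks len)
    also have "\<dots> = set (sorted_list_of_set S)"
      by (auto simp: set_conv_nth)
    finally show ?thesis using S by simp
  qed
  let ?N = "{1..ground_size t + ground_size h}"
  have fin: "finite {S. S \<subseteq> ?N \<and> card S = ground_size t}"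
    by (rule finite_subset[of _ "Pow ?N"]) auto
  obtain S where S: "S \<subseteq> ?N" "card S = ground_size t" "p = shift S t \<union> shift (?N - S) h"
    using p fin by (auto simp: arc_shuffle_def)
  have "finite S" using S(1) finite_subset by blast
  then have "card (?N - S) = ground_size h"
    using S by (simp add: card_Diff_subset)
  then have "\<Union>p = ?N"
    using shift_ground[OF t \<open>finite S\<close> S(2)] shift_ground[OF h, of "?N - S"] S by auto
  then show ?thesis by (simp add: ground_size_def)
qed

lemma class_algebra_mult:
  assumes compat: "weakly_shuffle_compatible st"
    and t: "t \<in> set_partitions" and h: "h \<in> set_partitions"
  shows "basis_vec (st_class st t) \<otimes>\<^bsub>class_algebra st\<^esub> basis_vec (st_class st h) =
    (\<Sum>p\<in>#arc_shuffle t h. basis_vec (st_class st p))"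
proof -
  have scale1: "pm_scale 1 f = f" for f :: "'b \<Rightarrow>\<^sub>0 rat"
    unfolding pm_scale_def by transfer (auto simp: when_def)
  define t' where "t' = (SOME s. s \<in> st_class st t)"
  define h' where "h' = (SOME s. s \<in> st_class st h)"
  have "t \<in> st_class st t" "h \<in> st_class st h"
    using t h by (auto simp: st_class_def)
  then have "t' \<in> st_class st t" "h' \<in> st_class st h"
    unfolding t'_def h'_def by (auto intro: someI)
  then have t': "t' \<in> set_partitions" "st t' = st t" "ground_size t' = ground_size t"
    and h': "h' \<in> set_partitions" "st h' = st h" "ground_size h' = ground_size h"
    by (auto simp: st_class_def)
  let ?F = "\<lambda>s. {q \<in> set_partitions. st q = s \<and> ground_size q = ground_size t + ground_size h}"
  have cls: "image_mset (st_class st) (arc_shuffle a b) = image_mset ?F (image_mset st (arc_shuffle a b))"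
    if "a \<in> set_partitions" "b \<in> set_partitions" "ground_size a = ground_size t" "ground_size b = ground_size h" for a b
    unfolding image_mset.compositionality o_def
    by (rule image_mset_cong)
      (use ground_size_arc_shuffle[OF that(1,2)] that in \<open>simp add: st_class_def\<close>)
  have "image_mset st (arc_shuffle t' h') = image_mset st (arc_shuffle t h)"
    using compat t h t' h' unfolding weakly_shuffle_compatible_def by blast
  then have "class_shuffle st (st_class st t) (st_class st h) =
      image_mset (st_class st) (arc_shuffle t h)"
    using cls[of t' h'] cls[of t h] t h t' h'
    by (simp add: class_shuffle_def t'_def h'_def)
  then show ?thesis
    by (simp add: class_algebra_def table_algebra_def scale1 image_mset.compositionality o_def)
qed


section \<open>The shuffle algebra on binary words\<close>

definition binary_words :: "nat list set" where
  "binary_words = lists {0, 1}"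

text \<open>The interleaving of \<open>v\<close> and \<open>w\<close> in which \<open>v\<close> occupies the (0-based) positions in \<open>S\<close>.\<close>

definition interleave :: "nat set \<Rightarrow> 'a list \<Rightarrow> 'a list \<Rightarrow> 'a list" where
  "interleave S v w =
     map (\<lambda>i. if i \<in> S then v ! card {j \<in> S. j < i} else w ! card {j. j \<notin> S \<and> j < i})
       [0..<length v + length w]"

definition word_shuffle :: "'a list \<Rightarrow> 'a list \<Rightarrow> 'a list multiset" where
  "word_shuffle v w = image_mset (\<lambda>S. interleave S v w)
     (mset_set {S. S \<subseteq> {..<length v + length w} \<and> card S = length v})"

definition shuffle_algebra :: "(rat, nat list \<Rightarrow>\<^sub>0 rat) module" where
  "shuffle_algebra = table_algebra binary_words word_shuffle []"

definition Sg :: "nat set set \<Rightarrow> nat set" where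
  "Sg p = {i. {i} \<in> p}"

definition bw :: "nat \<Rightarrow> nat set \<Rightarrow> nat list" where
  "bw n T = map (\<lambda>i. if i \<in> T then 1 else 0) [1..<n + 1]"

text \<open>The condition on \<open>u\<close> is stated over the integers, since \<open>|u| - 1 = -1\<close> for the
  empty word.\<close>

definition Sg_span :: "(nat list \<Rightarrow>\<^sub>0 rat) set" where
  "Sg_span = module.span pm_scale
     {basis_vec u | u. u \<in> binary_words \<and> int (sum_list u) \<noteq> int (length u) - 1}"

end

(* The position of an element in its shifted copy is its rank, so {x} is a block of an arc-shuffle
   of t and h along S exactly if the element of the same rank is a singleton of t (for x in S) or of
   h (for x not in S). Hence the map p -> bw |p| (Sg p) turns arc-shuffles into word shuffles along
   the same S. It separates the classes of Sg and its image consists of the words that do not have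
   exactly one letter 0; everything else is transported along it from the shuffle algebra. *)

theory Submission
  imports Defs
begin

section \<open>Algebras with a multiplication table\<close>

text \<open>A product of two classes is computed from chosen representatives, so a direct proof of
  associativity would have to compare iterated arc-shuffles of unrelated partitions. Instead,
  multisets of classes are sent injectively to multisets of words, the law is applied there, and the
  injection is cancelled. The same device gives closure of the span: two words without exactly one
  zero never shuffle to a word with exactly one zero, because their shuffle is the image of an
  arc-shuffle. On the word side there are two competing descriptions of the shuffle. Subsets of
  positions match arc-shuffles but do not suit induction; the recursion on first letters does, and
  it is derived from the former. The linear algebra is kept apart from both: all ring laws are
  reduced to laws of a multiplication table on basis elements.\<close>

lemma image_mset_sum_mset: "image_mset f (\<Sum>x\<in>#M. g x) = (\<Sum>x\<in>#M. image_mset f (g x))"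
  by (induction M) simp_all

lemma carrier_rat_field [simp]: "carrier rat_field = UNIV"
  and mult_rat_field [simp]: "x \<otimes>\<^bsub>rat_field\<^esub> y = x * y"
  and add_rat_field [simp]: "x \<oplus>\<^bsub>rat_field\<^esub> y = x + y"
  and one_rat_field [simp]: "\<one>\<^bsub>rat_field\<^esub> = 1"
  by (simp_all add: ring_of_type_algebra_def)

lemma lookup_pm_scale [simp]: "Poly_Mapping.lookup (pm_scale c f) k = c * Poly_Mapping.lookup f k"
  unfolding pm_scale_def by transfer (auto simp: when_def)

interpretation pm: Modules.module pm_scale
  by unfold_locales (auto intro!: poly_mapping_eqI simp: lookup_add algebra_simps)

lemma keys_pm_scale: "Poly_Mapping.keys (pm_scale c f) \<subseteq> Poly_Mapping.keys f"
  by (auto simp: in_keys_iff)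

section \<open>Linear extension of maps prescribed on a basis\<close>

definition linear_extension :: "('a \<Rightarrow> 'b \<Rightarrow>\<^sub>0 rat) \<Rightarrow> ('a \<Rightarrow>\<^sub>0 rat) \<Rightarrow> 'b \<Rightarrow>\<^sub>0 rat" where
  "linear_extension F f =
     (\<Sum>u\<in>Poly_Mapping.keys f. pm_scale (Poly_Mapping.lookup f u) (F u))"

text \<open>Supports shrink under cancellation or scaling by 0, so \<open>f\<close>,
  \<open>g\<close> and \<open>f + g\<close> have no common index set by themselves. Enlarging the
  index set only adds terms with coefficient 0.\<close>

lemma linear_extension_superset:
  assumes "finite A" "Poly_Mapping.keys f \<subseteq> A"
  shows "linear_extension F f = (\<Sum>u\<in>A. pm_scale (Poly_Mapping.lookup f u) (F u))"
  unfolding linear_extension_def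
  by (rule sum.mono_neutral_left) (use assms in \<open>auto simp: in_keys_iff\<close>)

lemma linear_extension_add:
  "linear_extension F (f + g) = linear_extension F f + linear_extension F g"
proof -
  let ?A = "Poly_Mapping.keys f \<union> Poly_Mapping.keys g"
  have "Poly_Mapping.keys (f + g) \<subseteq> ?A"
    by (rule Poly_Mapping.keys_add)
  then show ?thesis
    by (simp add: linear_extension_superset[of ?A] lookup_add pm.scale_left_distrib sum.distrib)
qed

lemma linear_extension_scale:
  "linear_extension F (pm_scale c f) = pm_scale c (linear_extension F f)"
  by (subst linear_extension_superset[OF finite_keys keys_pm_scale])
    (simp add: linear_extension_def pm.scale_sum_right)

lemma linear_extension_0 [simp]: "linear_extension F 0 = 0"
  by (simp add: linear_extension_def)

lemma linear_extension_basis_vec [simp]: "linear_extension F (basis_vec u) = F u"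
  by (simp add: linear_extension_def)

lemma linear_extension_sum:
  "linear_extension F (\<Sum>x\<in>A. f x) = (\<Sum>x\<in>A. linear_extension F (f x))"
  by (induction A rule: infinite_finite_induct) (simp_all add: linear_extension_add)

lemma linear_extension_sum_mset:
  "linear_extension F (\<Sum>x\<in>#M. f x) = (\<Sum>x\<in>#M. linear_extension F (f x))"
  by (induction M) (simp_all add: linear_extension_add)

lemma linear_extension_fun_add:
  "linear_extension (\<lambda>u. F u + G u) f = linear_extension F f + linear_extension G f"
  by (simp add: linear_extension_def pm.scale_right_distrib sum.distrib)

lemma linear_extension_fun_sum_mset:
  "linear_extension (\<lambda>u. \<Sum>x\<in>#M. F x u) f = (\<Sum>x\<in>#M. linear_extension (F x) f)"
proof (induction M)
  case empty
  show ?case by (simp add: linear_extension_def)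
qed (simp add: linear_extension_fun_add)

lemma linear_extension_linear_extension:
  "linear_extension G (linear_extension F f) = linear_extension (\<lambda>u. linear_extension G (F u)) f"
  unfolding linear_extension_def[of F] linear_extension_sum linear_extension_scale
  by (simp add: linear_extension_def)

text \<open>Exchange of two finite sums; this is what reduces commutativity of a bilinear product to
  commutativity of its table.\<close>

lemma linear_extension_swap:
  "linear_extension (\<lambda>u. linear_extension (\<lambda>v. F u v) g) f =
   linear_extension (\<lambda>v. linear_extension (\<lambda>u. F u v) f) g"
  unfolding linear_extension_def pm.scale_sum_right pm.scale_scale
  by (subst sum.swap) (simp add: mult.commute)

lemma linear_extension_cong:
  "(\<And>u. u \<in> Poly_Mapping.keys f \<Longrightarrow> F u = G u) \<Longrightarrow> linear_extension F f = linear_extension G f"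
  by (simp add: linear_extension_def)

lemma linear_extension_id: "linear_extension basis_vec f = f"
  by (rule poly_mapping_eqI)
    (auto simp: linear_extension_def lookup_sum lookup_single when_def in_keys_iff
      if_distrib[of "(*) _"] cong: if_cong)

lemma keys_sum_subset:
  "(\<And>x. x \<in> A \<Longrightarrow> Poly_Mapping.keys (f x) \<subseteq> B) \<Longrightarrow> Poly_Mapping.keys (\<Sum>x\<in>A. f x) \<subseteq> B"
proof (induction A rule: infinite_finite_induct)
  case (insert x A)
  then show ?case
    using Poly_Mapping.keys_add[of "f x" "sum f A"] by auto
qed auto

lemma keys_linear_extension:
  assumes "\<And>u. u \<in> Poly_Mapping.keys f \<Longrightarrow> Poly_Mapping.keys (F u) \<subseteq> B"
  shows "Poly_Mapping.keys (linear_extension F f) \<subseteq> B"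
  unfolding linear_extension_def
  by (rule keys_sum_subset) (rule order_trans[OF keys_pm_scale assms])

definition formal_sum :: "'b multiset \<Rightarrow> 'b \<Rightarrow>\<^sub>0 rat" where
  "formal_sum M = (\<Sum>w\<in>#M. basis_vec w)"

lemma linear_extension_formal_sum: "linear_extension F (formal_sum M) = (\<Sum>w\<in>#M. F w)"
  by (simp add: formal_sum_def linear_extension_sum_mset)

lemma formal_sum_add: "formal_sum (M + N) = formal_sum M + formal_sum N"
  by (simp add: formal_sum_def)

lemma sum_mset_formal_sum: "(\<Sum>x\<in>#M. formal_sum (f x)) = formal_sum (\<Sum>x\<in>#M. f x)"
  by (induction M) (simp_all add: formal_sum_add, simp add: formal_sum_def)

lemma keys_formal_sum: "Poly_Mapping.keys (formal_sum M) \<subseteq> set_mset M"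
proof (induction M)
  case (add x M)
  then show ?case
    using Poly_Mapping.keys_add[of "basis_vec x" "formal_sum M"] by (auto simp: formal_sum_def)
qed (simp add: formal_sum_def)

section \<open>Ring laws reduced to laws of the multiplication table\<close>

lemma carrier_table_algebra [simp]: "carrier (table_algebra B m e) = {f. Poly_Mapping.keys f \<subseteq> B}"
  and one_table_algebra [simp]: "\<one>\<^bsub>table_algebra B m e\<^esub> = basis_vec e"
  and zero_table_algebra [simp]: "\<zero>\<^bsub>table_algebra B m e\<^esub> = 0"
  and add_table_algebra [simp]: "f \<oplus>\<^bsub>table_algebra B m e\<^esub> g = f + g"
  and smult_table_algebra [simp]: "c \<odot>\<^bsub>table_algebra B m e\<^esub> f = pm_scale c f"
  by (simp_all add: table_algebra_def)

lemma mult_table_algebra: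
  "f \<otimes>\<^bsub>table_algebra B m e\<^esub> g =
     linear_extension (\<lambda>u. linear_extension (\<lambda>v. formal_sum (m u v)) g) f"
  by (simp add: table_algebra_def linear_extension_def formal_sum_def pm.scale_sum_right)

text \<open>The laws are required on \<open>B\<close> only: a table built from chosen
  representatives, such as \<open>class_shuffle\<close>, has no meaning away from actual
  classes.\<close>

locale multiplication_table =
  fixes B :: "'b set" and m :: "'b \<Rightarrow> 'b \<Rightarrow> 'b multiset" and e :: 'b
  assumes closed: "\<lbrakk>u \<in> B; v \<in> B\<rbrakk> \<Longrightarrow> set_mset (m u v) \<subseteq> B"
    and unit_closed: "e \<in> B"
    and comm: "\<lbrakk>u \<in> B; v \<in> B\<rbrakk> \<Longrightarrow> m u v = m v u"
    and assoc: "\<lbrakk>u \<in> B; v \<in> B; w \<in> B\<rbrakk> \<Longrightarrow> (\<Sum>x\<in>#m u v. m x w) = (\<Sum>y\<in>#m v w. m u y)"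
    and unit: "u \<in> B \<Longrightarrow> m e u = {#u#}"
begin

abbreviation A where "A \<equiv> table_algebra B m e"

text \<open>The set \<open>C\<close> is kept general: \<open>C = B\<close> gives closure of the
  whole algebra, a smaller \<open>C\<close> closure of a subring.\<close>

lemma mult_keys_subset:
  assumes C: "\<And>u v. \<lbrakk>u \<in> C; v \<in> C\<rbrakk> \<Longrightarrow> set_mset (m u v) \<subseteq> C"
    and "Poly_Mapping.keys f \<subseteq> C" "Poly_Mapping.keys g \<subseteq> C"
  shows "Poly_Mapping.keys (f \<otimes>\<^bsub>A\<^esub> g) \<subseteq> C"
  unfolding mult_table_algebra
  by (intro keys_linear_extension order_trans[OF keys_formal_sum] C) (use assms in blast)+

lemma cring_table_algebra: "cring A"
proof (rule cringI)
  show "abelian_group A"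
  proof (rule abelian_groupI)
    fix f g assume "f \<in> carrier A" "g \<in> carrier A"
    then show "f \<oplus>\<^bsub>A\<^esub> g \<in> carrier A"
      using Poly_Mapping.keys_add[of f g] by auto
  next
    fix f assume "f \<in> carrier A"
    then show "\<exists>g\<in>carrier A. g \<oplus>\<^bsub>A\<^esub> f = \<zero>\<^bsub>A\<^esub>"
      by (intro bexI[of _ "- f"]) (auto simp: in_keys_iff)
  qed (auto simp: ac_simps)
next
  show "comm_monoid A"
  proof (rule comm_monoidI)
    fix f g assume fg: "f \<in> carrier A" "g \<in> carrier A"
    then show "f \<otimes>\<^bsub>A\<^esub> g \<in> carrier A"
      using mult_keys_subset[OF closed] by simp
    have "f \<otimes>\<^bsub>A\<^esub> g = linear_extension (\<lambda>u. linear_extension (\<lambda>v. formal_sum (m v u)) g) f"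
      unfolding mult_table_algebra
      by (intro linear_extension_cong arg_cong[of _ _ formal_sum] comm) (use fg in auto)
    then show "f \<otimes>\<^bsub>A\<^esub> g = g \<otimes>\<^bsub>A\<^esub> f"
      unfolding mult_table_algebra by (subst (asm) linear_extension_swap)
  next
    fix f g h assume fgh: "f \<in> carrier A" "g \<in> carrier A" "h \<in> carrier A"
    \<comment> \<open>Both bracketings become the same triple extension, over the supports of
      \<open>f\<close>, \<open>g\<close> and \<open>h\<close>, of a formal sum over a summed table
      entry, where \<open>assoc\<close> applies. On this side the sum over \<open>x\<close> first
      has to be pulled inside the extension over \<open>w\<close>.\<close>
    have "f \<otimes>\<^bsub>A\<^esub> g \<otimes>\<^bsub>A\<^esub> h = linear_extension (\<lambda>u. linear_extension (\<lambda>v.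
        linear_extension (\<lambda>w. formal_sum (\<Sum>x\<in>#m u v. m x w)) h) g) f"
      unfolding mult_table_algebra linear_extension_linear_extension linear_extension_formal_sum
        linear_extension_fun_sum_mset[symmetric] sum_mset_formal_sum ..
    also have "\<dots> = linear_extension (\<lambda>u. linear_extension (\<lambda>v.
        linear_extension (\<lambda>w. formal_sum (\<Sum>y\<in>#m v w. m u y)) h) g) f"
      by (intro linear_extension_cong arg_cong[of _ _ formal_sum] assoc) (use fgh in auto)
    also have "\<dots> = f \<otimes>\<^bsub>A\<^esub> (g \<otimes>\<^bsub>A\<^esub> h)"
      unfolding mult_table_algebra linear_extension_linear_extension linear_extension_formal_sum
        sum_mset_formal_sum ..
    finally show "f \<otimes>\<^bsub>A\<^esub> g \<otimes>\<^bsub>A\<^esub> h = f \<otimes>\<^bsub>A\<^esub> (g \<otimes>\<^bsub>A\<^esub> h)" .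
  next
    fix f assume f: "f \<in> carrier A"
    have "\<one>\<^bsub>A\<^esub> \<otimes>\<^bsub>A\<^esub> f = linear_extension (\<lambda>v. formal_sum (m e v)) f"
      by (simp add: mult_table_algebra)
    also have "\<dots> = linear_extension basis_vec f"
      by (rule linear_extension_cong) (use f unit in \<open>auto simp: formal_sum_def\<close>)
    finally show "\<one>\<^bsub>A\<^esub> \<otimes>\<^bsub>A\<^esub> f = f"
      by (simp add: linear_extension_id)
  qed (use unit_closed in auto)
qed (simp add: mult_table_algebra linear_extension_add)

lemma algebra_table_algebra: "algebra rat_field A"
proof (rule algebraI)
  show "cring rat_field" by (rule cring_from_type_algebra)
  show "cring A" by (rule cring_table_algebra)
qed (use keys_pm_scale in \<open>force simp: pm.scale_left_distrib pm.scale_right_distrib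
    mult_table_algebra linear_extension_scale\<close>)+

text \<open>The additive inverse of a ring is given by a description inside its carrier; closure of
  a submodule under it can be read off supports only after it is identified with pointwise
  negation.\<close>

lemma minus_table_algebra:
  assumes "f \<in> carrier A"
  shows "\<ominus>\<^bsub>A\<^esub> f = - f"
proof -
  interpret cring A by (rule cring_table_algebra)
  show ?thesis
    by (rule minus_equality) (use assms in \<open>auto simp: in_keys_iff\<close>)
qed

lemma submodule_subset:
  assumes "C \<subseteq> B"
  shows "submodule {f. Poly_Mapping.keys f \<subseteq> C} rat_field A"
proof -
  interpret algebra rat_field A by (rule algebra_table_algebra)
  show ?thesis
  proof (rule submoduleI)
    show "{f. Poly_Mapping.keys f \<subseteq> C} \<subseteq> carrier A"
      using assms by auto
    fix f g :: "'b \<Rightarrow>\<^sub>0 rat" and c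
    assume f: "f \<in> {f. Poly_Mapping.keys f \<subseteq> C}"
    then have "f \<in> carrier A" using assms by auto
    then show "\<ominus>\<^bsub>A\<^esub> f \<in> {f. Poly_Mapping.keys f \<subseteq> C}"
      using f by (auto simp: minus_table_algebra in_keys_iff)
    show "c \<odot>\<^bsub>A\<^esub> f \<in> {f. Poly_Mapping.keys f \<subseteq> C}"
      using f keys_pm_scale[of c f] by auto
    assume "g \<in> {f. Poly_Mapping.keys f \<subseteq> C}"
    then show "f \<oplus>\<^bsub>A\<^esub> g \<in> {f. Poly_Mapping.keys f \<subseteq> C}"
      using f Poly_Mapping.keys_add[of f g] by auto
  qed simp
qed

lemma subring_subset:
  assumes "C \<subseteq> B" "e \<in> C" "\<And>u v. \<lbrakk>u \<in> C; v \<in> C\<rbrakk> \<Longrightarrow> set_mset (m u v) \<subseteq> C"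
  shows "subring {f. Poly_Mapping.keys f \<subseteq> C} A"
proof -
  interpret algebra rat_field A by (rule algebra_table_algebra)
  note E = submoduleE[OF submodule_subset[OF assms(1)]]
  show ?thesis
    by (rule subringI)
      (use E(1,3,5) assms(2) mult_keys_subset[OF assms(3)] in \<open>auto simp del: add_table_algebra\<close>)
qed

end

section \<open>Spans of basis vectors, and linear maps determined by a basis\<close>

lemma span_basis_vec:
  "pm.span {basis_vec u | u. u \<in> C} = {f. Poly_Mapping.keys f \<subseteq> C}"
proof (intro equalityI subsetI)
  fix f assume "f \<in> pm.span {basis_vec u | u. u \<in> C}"
  then show "f \<in> {f. Poly_Mapping.keys f \<subseteq> C}"
  proof (induction rule: pm.span_induct_alt)
    case (step c x y)
    then have "Poly_Mapping.keys (pm_scale c x) \<subseteq> C"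
      using keys_pm_scale[of c x] by auto
    with step show ?case
      using Poly_Mapping.keys_add[of "pm_scale c x" y] by blast
  qed simp
next
  fix f :: "'a \<Rightarrow>\<^sub>0 rat" assume f: "f \<in> {f. Poly_Mapping.keys f \<subseteq> C}"
  have "linear_extension basis_vec f \<in> pm.span {basis_vec u | u. u \<in> C}"
    unfolding linear_extension_def
    by (intro pm.span_sum pm.span_scale pm.span_base) (use f in auto)
  then show "f \<in> pm.span {basis_vec u | u. u \<in> C}"
    by (simp add: linear_extension_id)
qed

lemma linear_maps_table_algebra:
  assumes T: "T \<in> linear_maps rat_field (table_algebra B m e) (table_algebra B' m' e')"
    and f: "Poly_Mapping.keys f \<subseteq> B"
  shows "T f = linear_extension (\<lambda>u. T (basis_vec u)) f"
proof -
  have add: "T (x + y) = T x + T y" if "Poly_Mapping.keys x \<subseteq> B" "Poly_Mapping.keys y \<subseteq> B" for x y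
    using T that by (auto simp: linear_maps_def)
  have scale: "T (pm_scale c x) = pm_scale c (T x)" if "Poly_Mapping.keys x \<subseteq> B" for c x
    using T that by (auto simp: linear_maps_def)
  have zero: "T 0 = 0"
    using scale[of 0 0] by simp
  \<comment> \<open>Linearity of \<open>T\<close> is available on the carrier only, so the induction
    also checks that every partial sum is supported in \<open>B\<close>.\<close>
  have "T (\<Sum>u\<in>K. pm_scale (c u) (basis_vec u)) = (\<Sum>u\<in>K. pm_scale (c u) (T (basis_vec u)))"
    if "finite K" "K \<subseteq> B" for K c
    using that
  proof (induction K rule: finite_induct)
    case (insert u K)
    have "Poly_Mapping.keys (pm_scale (c u) (basis_vec u)) \<subseteq> B"
      using keys_pm_scale[of "c u" "basis_vec u"] insert.prems by auto
    moreover have "Poly_Mapping.keys (\<Sum>u\<in>K. pm_scale (c u) (basis_vec u)) \<subseteq> B"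
      by (intro keys_sum_subset order_trans[OF keys_pm_scale]) (use insert.prems in auto)
    ultimately show ?case
      using insert by (simp add: add scale)
  qed (simp add: zero)
  from this[OF finite_keys f] show ?thesis
    by (metis linear_extension_def linear_extension_id)
qed

section \<open>Transport of a table along an injective map\<close>

text \<open>Commutativity and associativity are assumed for the target alone and pulled back along
  \<open>\<phi>\<close>. Surjectivity is not asked for, since the words with exactly one zero are
  missed.\<close>

locale table_embedding = target: multiplication_table B' m' e'
  for B' :: "'b set" and m' :: "'b \<Rightarrow> 'b \<Rightarrow> 'b multiset" and e' :: 'b +
  fixes B :: "'a set" and m :: "'a \<Rightarrow> 'a \<Rightarrow> 'a multiset" and e :: 'a and \<phi> :: "'a \<Rightarrow> 'b"
  assumes inj: "inj_on \<phi> B"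
    and into: "u \<in> B \<Longrightarrow> \<phi> u \<in> B'"
    and table_closed: "\<lbrakk>u \<in> B; v \<in> B\<rbrakk> \<Longrightarrow> set_mset (m u v) \<subseteq> B"
    and table_unit: "e \<in> B" "\<phi> e = e'"
    and table_hom: "\<lbrakk>u \<in> B; v \<in> B\<rbrakk> \<Longrightarrow> image_mset \<phi> (m u v) = m' (\<phi> u) (\<phi> v)"
begin

abbreviation "source_algebra \<equiv> table_algebra B m e"
abbreviation "target_algebra \<equiv> table_algebra B' m' e'"

text \<open>Applying \<open>inv_into B \<phi>\<close> elementwise undoes \<open>\<phi>\<close> on
  multisets supported in \<open>B\<close>.\<close>

lemma image_mset_inject:
  assumes "set_mset M \<subseteq> B" "set_mset N \<subseteq> B" "image_mset \<phi> M = image_mset \<phi> N"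
  shows "M = N"
proof -
  have "image_mset (inv_into B \<phi>) (image_mset \<phi> K) = K" if "set_mset K \<subseteq> B" for K
  proof -
    have "image_mset (inv_into B \<phi>) (image_mset \<phi> K) = image_mset (\<lambda>x. x) K"
      unfolding image_mset.compositionality o_def
      by (rule image_mset_cong) (use that inj in \<open>auto simp: inv_into_f_f\<close>)
    then show ?thesis by simp
  qed
  from this[OF assms(1)] this[OF assms(2)] show ?thesis
    unfolding assms(3) by (rule trans[OF sym])
qed

text \<open>By \<open>table_hom\<close>, the image under \<open>\<phi>\<close> of each law is the
  corresponding law of the target table; \<open>image_mset_inject\<close> then cancels
  \<open>\<phi>\<close>.\<close>

lemma multiplication_table: "multiplication_table B m e"
proof
  show "set_mset (m u v) \<subseteq> B" if "u \<in> B" "v \<in> B" for u v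
    using that by (rule table_closed)
  show "m u v = m v u" if "u \<in> B" "v \<in> B" for u v
    by (intro image_mset_inject table_closed that)
      (simp only: table_hom[OF that] table_hom[OF that(2,1)] target.comm[OF into into, OF that])
  show "m e u = {#u#}" if "u \<in> B" for u
    by (rule image_mset_inject)
      (use that table_unit table_closed target.unit[OF into] in \<open>simp_all add: table_hom\<close>)
  show "(\<Sum>x\<in>#m u v. m x w) = (\<Sum>y\<in>#m v w. m u y)" if uvw: "u \<in> B" "v \<in> B" "w \<in> B" for u v w
  proof (rule image_mset_inject)
    show "set_mset (\<Sum>x\<in>#m u v. m x w) \<subseteq> B" "set_mset (\<Sum>y\<in>#m v w. m u y) \<subseteq> B"
      using uvw table_closed[of u v] table_closed[of v w] table_closed[of _ w] table_closed[of u]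
      by fastforce+
    have left: "image_mset \<phi> (\<Sum>x\<in>#m u v. m x w) = (\<Sum>x\<in>#m u v. m' (\<phi> x) (\<phi> w))"
      unfolding image_mset_sum_mset
      by (intro arg_cong[of _ _ sum_mset] image_mset_cong table_hom)
        (use uvw table_closed[of u v] in auto)
    have right: "image_mset \<phi> (\<Sum>y\<in>#m v w. m u y) = (\<Sum>y\<in>#m v w. m' (\<phi> u) (\<phi> y))"
      unfolding image_mset_sum_mset
      by (intro arg_cong[of _ _ sum_mset] image_mset_cong table_hom)
        (use uvw table_closed[of v w] in auto)
    have "(\<Sum>x\<in>#image_mset \<phi> (m u v). m' x (\<phi> w)) = (\<Sum>y\<in>#image_mset \<phi> (m v w). m' (\<phi> u) y)"
      unfolding table_hom[OF uvw(1,2)] table_hom[OF uvw(2,3)]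
      by (intro target.assoc into uvw)
    then show "image_mset \<phi> (\<Sum>x\<in>#m u v. m x w) = image_mset \<phi> (\<Sum>y\<in>#m v w. m u y)"
      by (simp only: left right image_mset.compositionality o_def)
  qed
qed (rule table_unit)

text \<open>A product of two images is the image of a product in \<open>B\<close>, so the image
  carries a subring without any look at the target elements.\<close>

lemma image_table_closed:
  "\<lbrakk>x \<in> \<phi> ` B; y \<in> \<phi> ` B\<rbrakk> \<Longrightarrow> set_mset (m' x y) \<subseteq> \<phi> ` B"
  using table_closed by (force simp: table_hom[symmetric])

lemma linear_extension_in_linear_maps:
  "linear_extension (\<lambda>u. basis_vec (\<phi> u)) \<in> linear_maps rat_field source_algebra target_algebra"
proof -
  have "Poly_Mapping.keys (linear_extension (\<lambda>u. basis_vec (\<phi> u)) f) \<subseteq> B'"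
    if "Poly_Mapping.keys f \<subseteq> B" for f
    by (rule keys_linear_extension) (use that into in auto)
  then show ?thesis
    unfolding linear_maps_def
    by (intro CollectI conjI ballI funcsetI)
      (simp_all only: carrier_table_algebra mem_Collect_eq add_table_algebra smult_table_algebra
        linear_extension_add linear_extension_scale)
qed

lemma linear_map_is_iso:
  assumes T: "T \<in> linear_maps rat_field source_algebra target_algebra"
    and basis: "\<And>u. u \<in> B \<Longrightarrow> T (basis_vec u) = basis_vec (\<phi> u)"
  shows "T \<in> algebra_isos rat_field source_algebra
           (target_algebra\<lparr>carrier := {f. Poly_Mapping.keys f \<subseteq> \<phi> ` B}\<rparr>)"
proof -
  let ?L = "linear_extension (\<lambda>u. basis_vec (\<phi> u))"
  \<comment> \<open>The candidate inverse: the linear extension of the inverse of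
    \<open>\<phi>\<close> on basis elements.\<close>
  let ?L' = "linear_extension (\<lambda>x. basis_vec (inv_into B \<phi> x))"
  have T_eq: "T f = ?L f" if "Poly_Mapping.keys f \<subseteq> B" for f
    using linear_maps_table_algebra[OF T that]
    by (rule trans) (rule linear_extension_cong, use basis that in auto)
  have L: "Poly_Mapping.keys (?L f) \<subseteq> \<phi> ` B" if "Poly_Mapping.keys f \<subseteq> B" for f
    by (rule keys_linear_extension) (use that in auto)
  have L': "Poly_Mapping.keys (?L' f) \<subseteq> B" if "Poly_Mapping.keys f \<subseteq> \<phi> ` B" for f
    by (rule keys_linear_extension) (use that in \<open>auto simp: inv_into_into\<close>)
  have L'L: "?L' (?L f) = f" if "Poly_Mapping.keys f \<subseteq> B" for f
  proof -
    have "?L' (?L f) = linear_extension basis_vec f"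
      unfolding linear_extension_linear_extension linear_extension_basis_vec
      by (rule linear_extension_cong) (use that inj in \<open>auto simp: inv_into_f_f\<close>)
    then show ?thesis by (simp add: linear_extension_id)
  qed
  have LL': "?L (?L' f) = f" if "Poly_Mapping.keys f \<subseteq> \<phi> ` B" for f
  proof -
    have "?L (?L' f) = linear_extension basis_vec f"
      unfolding linear_extension_linear_extension linear_extension_basis_vec
      by (rule linear_extension_cong) (use that in \<open>auto simp: f_inv_into_f\<close>)
    then show ?thesis by (simp add: linear_extension_id)
  qed
  have L_mult: "?L (f \<otimes>\<^bsub>source_algebra\<^esub> g) = ?L f \<otimes>\<^bsub>target_algebra\<^esub> ?L g"
    if fg: "Poly_Mapping.keys f \<subseteq> B" "Poly_Mapping.keys g \<subseteq> B" for f g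
  proof -
    have formal: "?L (formal_sum M) = formal_sum (image_mset \<phi> M)" for M
      unfolding linear_extension_formal_sum
      by (simp add: formal_sum_def image_mset.compositionality o_def)
    show ?thesis
      unfolding mult_table_algebra linear_extension_linear_extension linear_extension_basis_vec formal
      by (intro linear_extension_cong arg_cong[of _ _ formal_sum] table_hom) (use fg in auto)
  qed
  interpret source: multiplication_table B m e by (rule multiplication_table)
  \<comment> \<open>\<open>T\<close> is known to agree with \<open>?L\<close> only on the carrier,
    so a product has to be placed there before \<open>L_mult\<close> says anything about
    \<open>T\<close>.\<close>
  have src_mult: "Poly_Mapping.keys (f \<otimes>\<^bsub>source_algebra\<^esub> g) \<subseteq> B"
    if "Poly_Mapping.keys f \<subseteq> B" "Poly_Mapping.keys g \<subseteq> B" for f g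
    using source.mult_keys_subset[OF table_closed] that by simp
  have "bij_betw T {f. Poly_Mapping.keys f \<subseteq> B} {f. Poly_Mapping.keys f \<subseteq> \<phi> ` B}"
    by (rule bij_betw_byWitness[of _ ?L']) (simp_all add: T_eq L'L LL' L L' image_subset_iff)
  then have "T \<in> ring_iso source_algebra
      (target_algebra\<lparr>carrier := {f. Poly_Mapping.keys f \<subseteq> \<phi> ` B}\<rparr>)"
    using T_eq L
    by (intro ring_iso_memI)
      (auto simp: T_eq L_mult src_mult linear_extension_add table_unit basis
        order_trans[OF Poly_Mapping.keys_add])
  moreover have "T \<in> linear_maps rat_field source_algebra
      (target_algebra\<lparr>carrier := {f. Poly_Mapping.keys f \<subseteq> \<phi> ` B}\<rparr>)"
    using T T_eq L by (auto simp: linear_maps_def)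
  ultimately show ?thesis by (simp add: algebra_isos_def)
qed

end

section \<open>The shuffle product of words\<close>

lemma finite_subsets_card: "finite {S. S \<subseteq> {..<n::nat} \<and> card S = k}"
  by (rule finite_subset[of _ "Pow {..<n}"]) auto

text \<open>Pascal's rule as a statement about sets: split by whether 0 belongs to \<open>S\<close>,
  and move the remaining elements down by one.\<close>

lemma subsets_card_Suc:
  "{S. S \<subseteq> {..<Suc n} \<and> card S = Suc k} =
     (\<lambda>S. insert 0 (Suc ` S)) ` {S. S \<subseteq> {..<n} \<and> card S = k} \<union>
     image Suc ` {S. S \<subseteq> {..<n} \<and> card S = Suc k}" (is "?L = ?R")
proof (intro equalityI subsetI)
  fix S assume S: "S \<in> ?L"
  define T where "T = {i. Suc i \<in> S}"
  have T: "T \<subseteq> {..<n}" using S by (auto simp: T_def)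
  then have fin: "finite T" by (rule finite_subset) simp
  show "S \<in> ?R"
  proof (cases "0 \<in> S")
    case True
    have "x \<in> S \<longleftrightarrow> x \<in> insert 0 (Suc ` T)" for x
      using True by (cases x) (auto simp: T_def)
    then have eq: "S = insert 0 (Suc ` T)" by blast
    then have "card S = Suc (card T)" using fin by (simp add: card_image)
    then show ?thesis using S T eq by auto
  next
    case False
    have "x \<in> S \<longleftrightarrow> x \<in> Suc ` T" for x
      using False by (cases x) (auto simp: T_def)
    then have eq: "S = Suc ` T" by blast
    then have "card S = card T" by (simp add: card_image)
    then show ?thesis using S T eq by auto
  qed
next
  fix S assume "S \<in> ?R"
  then show "S \<in> ?L"
  proof
    assume "S \<in> (\<lambda>S. insert 0 (Suc ` S)) ` {S. S \<subseteq> {..<n} \<and> card S = k}"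
    then obtain T where T: "T \<subseteq> {..<n}" "card T = k" "S = insert 0 (Suc ` T)" by auto
    then have "finite T" using finite_subset by blast
    then show ?thesis using T by (auto simp: card_image)
  next
    assume "S \<in> image Suc ` {S. S \<subseteq> {..<n} \<and> card S = Suc k}"
    then show ?thesis by (auto simp: card_image)
  qed
qed

text \<open>Position 0 takes the first letter of the left word. Every later rank inside the position
  set rises by one, while ranks in its complement stay, so the rest reads \<open>v\<close> and
  \<open>w\<close> as before.\<close>

lemma interleave_insert_0:
  "interleave (insert 0 (Suc ` S)) (a # v) w = a # interleave S v w"
proof -
  have 1: "card {j \<in> insert 0 (Suc ` S). j < Suc i} = Suc (card {j \<in> S. j < i})" for i
  proof -
    have "{j \<in> insert 0 (Suc ` S). j < Suc i} = insert 0 (Suc ` {j \<in> S. j < i})" by auto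
    then show ?thesis by (simp add: card_image)
  qed
  have 2: "card {j. j \<notin> insert 0 (Suc ` S) \<and> j < Suc i} = card {j. j \<notin> S \<and> j < i}" for i
  proof -
    have "j \<in> {j. j \<notin> insert 0 (Suc ` S) \<and> j < Suc i} \<longleftrightarrow> j \<in> Suc ` {j. j \<notin> S \<and> j < i}" for j
      by (cases j) auto
    then have "{j. j \<notin> insert 0 (Suc ` S) \<and> j < Suc i} = Suc ` {j. j \<notin> S \<and> j < i}"
      by blast
    then show ?thesis by (simp add: card_image)
  qed
  have upt: "[0..<length (a # v) + length w] = 0 # map Suc [0..<length v + length w]"
    by (simp add: map_Suc_upt upt_conv_Cons del: upt_Suc)
  have 3: "Suc i \<in> insert 0 (Suc ` S) \<longleftrightarrow> i \<in> S" for i by auto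
  show ?thesis
    unfolding interleave_def upt list.map map_map o_def 1 2 3 by simp
qed

text \<open>The mirror case: 0 lies in the complement, so now the complementary ranks rise by
  one.\<close>

lemma interleave_Suc_image:
  "interleave (Suc ` S) v (b # w) = b # interleave S v w"
proof -
  have 1: "card {j \<in> Suc ` S. j < Suc i} = card {j \<in> S. j < i}" for i
  proof -
    have "{j \<in> Suc ` S. j < Suc i} = Suc ` {j \<in> S. j < i}" by auto
    then show ?thesis by (simp add: card_image)
  qed
  have 2: "card {j. j \<notin> Suc ` S \<and> j < Suc i} = Suc (card {j. j \<notin> S \<and> j < i})" for i
  proof -
    have "j \<in> {j. j \<notin> Suc ` S \<and> j < Suc i} \<longleftrightarrow> j \<in> insert 0 (Suc ` {j. j \<notin> S \<and> j < i})" for j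
      by (cases j) auto
    then have "{j. j \<notin> Suc ` S \<and> j < Suc i} = insert 0 (Suc ` {j. j \<notin> S \<and> j < i})"
      by blast
    then show ?thesis by (simp add: card_image)
  qed
  have upt: "[0..<length v + length (b # w)] = 0 # map Suc [0..<length v + length w]"
    by (simp add: map_Suc_upt upt_conv_Cons del: upt_Suc)
  have 3: "Suc i \<in> Suc ` S \<longleftrightarrow> i \<in> S" for i by auto
  show ?thesis
    unfolding interleave_def upt list.map map_map o_def 1 2 3 by simp
qed

lemma word_shuffle_Nil_left [simp]: "word_shuffle [] w = {#w#}"
proof -
  have "{S. S \<subseteq> {..<length w} \<and> card S = 0} = {{}}"
    using finite_subset[OF _ finite_lessThan] by auto
  then show ?thesis
    by (simp add: word_shuffle_def interleave_def map_nth)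
qed

lemma word_shuffle_Nil_right [simp]: "word_shuffle v [] = {#v#}"
proof -
  have "{S. S \<subseteq> {..<length v} \<and> card S = length v} = {{..<length v}}"
    using card_subset_eq[of "{..<length v}"] by auto
  moreover have "interleave {..<length v} v [] = v"
  proof (rule nth_equalityI)
    fix i assume "i < length (interleave {..<length v} v [])"
    then have "i < length v" by (simp add: interleave_def)
    then have "{j \<in> {..<length v}. j < i} = {j. j < i}" by auto
    then show "interleave {..<length v} v [] ! i = v ! i"
      using \<open>i < length v\<close> by (simp add: interleave_def)
  qed (simp add: interleave_def)
  ultimately show ?thesis
    by (simp add: word_shuffle_def)
qed

text \<open>The classical recursion for the shuffle product: the position set contains 0 exactly
  when the first letter is taken from the left word.\<close>

lemma word_shuffle_Cons_Cons:
  "word_shuffle (a # v) (b # w) =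
     image_mset ((#) a) (word_shuffle v (b # w)) + image_mset ((#) b) (word_shuffle (a # v) w)"
proof -
  \<comment> \<open>Both shuffles on the right-hand side have total length \<open>N\<close>, so
    their position sets come from the same families \<open>?P k\<close>.\<close>
  define N where "N = length v + length (b # w)"
  let ?P = "\<lambda>k. {S. S \<subseteq> {..<N} \<and> card S = k}"
  have inj1: "inj_on (\<lambda>S. insert 0 (Suc ` S)) (?P k)" for k
    by (rule inj_onI) (simp add: insert_ident inj_image_eq_iff)
  have inj2: "inj_on (image Suc) (?P k)" for k
    by (rule inj_onI) (simp add: inj_image_eq_iff)
  have len: "Suc (length v) + length (b # w) = Suc N" "Suc (length v) + length w = N"
    "length (a # v) = Suc (length v)"
    by (simp_all add: N_def)
  have "mset_set {S. S \<subseteq> {..<Suc N} \<and> card S = Suc (length v)} =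
      mset_set ((\<lambda>S. insert 0 (Suc ` S)) ` ?P (length v)) + mset_set (image Suc ` ?P (Suc (length v)))"
    unfolding subsets_card_Suc by (rule mset_set_Union) (auto simp: finite_subsets_card)
  also have "\<dots> = image_mset (\<lambda>S. insert 0 (Suc ` S)) (mset_set (?P (length v))) +
      image_mset (image Suc) (mset_set (?P (Suc (length v))))"
    by (simp only: image_mset_mset_set[OF inj1] image_mset_mset_set[OF inj2])
  finally have split: "mset_set {S. S \<subseteq> {..<Suc N} \<and> card S = Suc (length v)} = \<dots>" .
  have "word_shuffle v (b # w) =
      image_mset (\<lambda>S. interleave S v (b # w)) (mset_set (?P (length v)))"
    by (simp only: word_shuffle_def N_def)
  moreover have "word_shuffle (a # v) w =
      image_mset (\<lambda>S. interleave S (a # v) w) (mset_set (?P (Suc (length v))))"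
    by (simp only: word_shuffle_def len)
  moreover have "word_shuffle (a # v) (b # w) = image_mset (\<lambda>S. interleave S (a # v) (b # w))
      (mset_set {S. S \<subseteq> {..<Suc N} \<and> card S = Suc (length v)})"
    by (simp only: word_shuffle_def len)
  ultimately show ?thesis
    by (simp only: split image_mset_union image_mset.compositionality o_def
        interleave_insert_0 interleave_Suc_image)
qed

section \<open>Letter content, commutativity and associativity of the shuffle\<close>

lemma mset_word_shuffle: "u \<in># word_shuffle v w \<Longrightarrow> mset u = mset v + mset w"
proof (induction v arbitrary: w u)
  case (Cons a v)
  note IH = Cons.IH
  from Cons.prems show ?case
  proof (induction w arbitrary: u)
    case (Cons b w)
    then show ?case
      by (auto simp: word_shuffle_Cons_Cons dest!: IH)
  qed simp
qed simp

lemma word_shuffle_commute: "word_shuffle v w = word_shuffle w v"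
proof (induction v arbitrary: w)
  case (Cons a v)
  note IH = Cons.IH
  show ?case
  proof (induction w)
    case (Cons b w)
    then show ?case
      by (simp add: word_shuffle_Cons_Cons IH[of "b # w"] add.commute)
  qed simp
qed simp

text \<open>Sorting both sides by the first letter of the result gives three parts, in each of which
  one of the three words has lost its first letter; hence the induction on total length.\<close>

lemma word_shuffle_assoc:
  fixes u v w :: "'a list"
  shows "(\<Sum>x\<in>#word_shuffle u v. word_shuffle x w) = (\<Sum>y\<in>#word_shuffle v w. word_shuffle u y)"
proof (induction "length u + length v + length w" arbitrary: u v w rule: less_induct)
  case less
  show ?case
  proof (cases "u = [] \<or> v = [] \<or> w = []")
    case True
    moreover have "word_shuffle ([] :: 'a list) = (\<lambda>w. {#w#})"
      by (rule ext) simp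
    ultimately show ?thesis by auto
  next
    case False
    then obtain a u' b v' c w' where eq: "u = a # u'" "v = b # v'" "w = c # w'"
      by (metis neq_Nil_conv)
    \<comment> \<open>Words starting with \<open>c\<close> arise for both possible first letters of
      \<open>x\<close>; the two contributions recombine into one sum over
      \<open>word_shuffle u v\<close>. On the right-hand side the same happens with
      \<open>a\<close>.\<close>
    have expand_left: "(\<Sum>x\<in>#word_shuffle u v. word_shuffle x w) =
        image_mset ((#) a) (\<Sum>x\<in>#word_shuffle u' v. word_shuffle x w) +
        image_mset ((#) b) (\<Sum>x\<in>#word_shuffle u v'. word_shuffle x w) +
        image_mset ((#) c) (\<Sum>x\<in>#word_shuffle u v. word_shuffle x w')"
      unfolding eq
      by (simp add: word_shuffle_Cons_Cons image_mset.compositionality o_def sum_mset.distrib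
          image_mset_sum_mset[symmetric] ac_simps)
    have expand_right: "(\<Sum>y\<in>#word_shuffle v w. word_shuffle u y) =
        image_mset ((#) a) (\<Sum>y\<in>#word_shuffle v w. word_shuffle u' y) +
        image_mset ((#) b) (\<Sum>y\<in>#word_shuffle v' w. word_shuffle u y) +
        image_mset ((#) c) (\<Sum>y\<in>#word_shuffle v w'. word_shuffle u y)"
      unfolding eq
      by (simp add: word_shuffle_Cons_Cons image_mset.compositionality o_def sum_mset.distrib
          image_mset_sum_mset[symmetric] ac_simps)
    have "(\<Sum>x\<in>#word_shuffle u' v. word_shuffle x w) = (\<Sum>y\<in>#word_shuffle v w. word_shuffle u' y)"
      "(\<Sum>x\<in>#word_shuffle u v'. word_shuffle x w) = (\<Sum>y\<in>#word_shuffle v' w. word_shuffle u y)"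
      "(\<Sum>x\<in>#word_shuffle u v. word_shuffle x w') = (\<Sum>y\<in>#word_shuffle v w'. word_shuffle u y)"
      by (rule less; simp add: eq)+
    then show ?thesis
      by (simp only: expand_left expand_right)
  qed
qed

section \<open>Singletons of an arc-shuffle\<close>

lemma set_partitions_partition_on:
  assumes "p \<in> set_partitions"
  shows "partition_on {1..ground_size p} p" "\<Union>p = {1..ground_size p}"
proof -
  obtain n where n: "partition_on {1..n} p"
    using assms by (auto simp: set_partitions_def)
  then have "\<Union>p = {1..n}" by (rule partition_onD1[symmetric])
  then show "partition_on {1..ground_size p} p" "\<Union>p = {1..ground_size p}"
    using n by (simp_all add: ground_size_def)
qed

text \<open>In a strictly increasing list the entries below the one at index \<open>k\<close> are
  exactly the \<open>k\<close> entries before it.\<close>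

lemma sorted_list_of_set_nth_rank:
  fixes S :: "nat set"
  assumes S: "finite S" and x: "x \<in> S"
  shows "sorted_list_of_set S ! card {j \<in> S. j < x} = x"
proof -
  let ?xs = "sorted_list_of_set S"
  obtain k where k: "k < length ?xs" "?xs ! k = x"
    using S x by (metis in_set_conv_nth set_sorted_list_of_set)
  have less: "?xs ! i < ?xs ! j \<longleftrightarrow> i < j" if "i < length ?xs" "j < length ?xs" for i j
    using that strict_sorted_list_of_set[of S]
    by (metis linorder_neqE_nat order_less_asym sorted_wrt_nth_less)
  have "{j \<in> S. j < x} = (!) ?xs ` {..<k}"
  proof (intro equalityI subsetI)
    fix j assume j: "j \<in> {j \<in> S. j < x}"
    then obtain i where "i < length ?xs" "?xs ! i = j"
      using S by (metis (no_types, lifting) in_set_conv_nth mem_Collect_eq set_sorted_list_of_set)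
    then show "j \<in> (!) ?xs ` {..<k}"
      using j k less by auto
  next
    fix j assume "j \<in> (!) ?xs ` {..<k}"
    then obtain i where "i < k" "j = ?xs ! i" by auto
    then show "j \<in> {j \<in> S. j < x}"
      using k less[of i k] S nth_mem[of i ?xs] by auto
  qed
  moreover have "inj_on ((!) ?xs) {..<k}"
    using k(1) by (intro inj_on_nth) auto
  ultimately have "card {j \<in> S. j < x} = k"
    by (simp add: card_image)
  then show ?thesis using k by simp
qed

text \<open>The ground set is an initial segment starting at 1, so the rank of \<open>i\<close> is
  \<open>i - 1\<close>; relabelling is then by a map that depends on \<open>S\<close> alone.\<close>

lemma shift_eq:
  assumes "p \<in> set_partitions"
  shows "shift S p = (`) (\<lambda>i. sorted_list_of_set S ! (i - 1)) ` p"
  unfolding shift_def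
proof (intro image_cong refl)
  fix C i assume "C \<in> p" "i \<in> C"
  then have "i \<in> {1..ground_size p}"
    using set_partitions_partition_on(2)[OF assms] by auto
  then have "{j \<in> \<Union>p. j < i} = {1..<i}"
    unfolding set_partitions_partition_on(2)[OF assms] by auto
  then show "sorted_list_of_set S ! card {j \<in> \<Union>p. j < i} = sorted_list_of_set S ! (i - 1)"
    by simp
qed

lemma bij_betw_shift:
  assumes "finite S"
  shows "bij_betw (\<lambda>i. sorted_list_of_set S ! (i - 1)) {1..card S} S"
proof -
  have "bij_betw (\<lambda>i. i - 1) {1..card S} {..<card S}"
    by (rule bij_betw_byWitness[of _ Suc]) auto
  moreover have "bij_betw ((!) (sorted_list_of_set S)) {..<card S} S"
    using assms by (intro bij_betw_nth) auto
  ultimately show ?thesis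
    by (auto dest: bij_betw_trans simp: o_def)
qed

lemma partition_on_shift:
  assumes p: "p \<in> set_partitions" and S: "finite S" "card S = ground_size p"
  shows "partition_on S (shift S p)"
proof -
  let ?r = "\<lambda>i. sorted_list_of_set S ! (i - 1)"
  have bij: "bij_betw ?r {1..ground_size p} S"
    using bij_betw_shift[OF S(1)] S(2) by simp
  have "partition_on (?r ` {1..ground_size p}) ((`) ?r ` p - {{}})"
    using bij by (intro partition_on_inj_image set_partitions_partition_on p) (simp add: bij_betw_def)
  \<comment> \<open>The image partition comes with the empty set removed; since no block is empty,
    nothing is lost.\<close>
  moreover have "{} \<notin> (`) ?r ` p"
    using partition_onD3[OF set_partitions_partition_on(1)[OF p]] by auto
  ultimately show ?thesis
    using bij by (simp add: shift_eq[OF p] bij_betw_def)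
qed

text \<open>Ranks count from 0 and ground sets from 1, hence the \<open>Suc\<close>. The relabelling
  is injective, so a block mapped onto \<open>{x}\<close> is itself the singleton of the preimage of
  \<open>x\<close>.\<close>

lemma singleton_in_shift:
  assumes p: "p \<in> set_partitions" and S: "finite S" "card S = ground_size p" and x: "x \<in> S"
  shows "{x} \<in> shift S p \<longleftrightarrow> {Suc (card {j \<in> S. j < x})} \<in> p"
proof -
  let ?r = "\<lambda>i. sorted_list_of_set S ! (i - 1)"
  let ?k = "Suc (card {j \<in> S. j < x})"
  have bij: "bij_betw ?r {1..ground_size p} S"
    using bij_betw_shift[OF S(1)] S(2) by simp
  have k: "?r ?k = x"
    using sorted_list_of_set_nth_rank[OF S(1) x] by simp
  have "card {j \<in> S. j < x} < card S"
    by (rule psubset_card_mono) (use S x in auto)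
  then have k_mem: "?k \<in> {1..ground_size p}" using S by simp
  show ?thesis
  proof
    assume "{x} \<in> shift S p"
    then obtain C where C: "C \<in> p" "?r ` C = {x}"
      by (auto simp: shift_eq[OF p])
    have sub: "C \<subseteq> {1..ground_size p}"
      using C(1) set_partitions_partition_on(2)[OF p] by blast
    have "?r ` C = ?r ` {?k}" using C k by simp
    then have "C = {?k}"
      using inj_on_image_eq_iff[OF bij_betw_imp_inj_on[OF bij] sub] k_mem by blast
    then show "{?k} \<in> p" using C by simp
  next
    assume "{?k} \<in> p"
    then show "{x} \<in> shift S p"
      unfolding shift_eq[OF p] by (rule rev_image_eqI) (simp add: sorted_list_of_set_nth_rank S(1) x)
  qed
qed

section \<open>The binary word of a partition, and its behaviour under arc-shuffles\<close>

lemma Sg_subset: "p \<in> set_partitions \<Longrightarrow> Sg p \<subseteq> {1..ground_size p}"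
  using set_partitions_partition_on(2) by (fastforce simp: Sg_def)

text \<open>One word records both invariants of a class: the ground size as its length, the
  singletons as the places of its ones.\<close>

definition Sg_word :: "nat set set \<Rightarrow> nat list" where
  "Sg_word p = bw (ground_size p) (Sg p)"

lemma length_bw [simp]: "length (bw n T) = n"
  by (simp add: bw_def)

lemma nth_bw: "i < n \<Longrightarrow> bw n T ! i = (if Suc i \<in> T then 1 else 0)"
  by (simp add: bw_def del: upt_Suc)

text \<open>The bounds on \<open>T\<close> and \<open>T'\<close> matter because \<open>bw\<close>
  forgets elements outside the ground set.\<close>

lemma bw_inject:
  assumes "bw n T = bw n' T'" "T \<subseteq> {1..n}" "T' \<subseteq> {1..n'}"
  shows "n = n' \<and> T = T'"
proof -
  have n: "n = n'" using assms(1) by (metis length_bw)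
  have mem: "i \<in> U \<longleftrightarrow> bw n U ! (i - 1) = 1" if "i \<in> {1..n}" for i U
    using that by (subst nth_bw) auto
  have "i \<in> T \<longleftrightarrow> i \<in> T'" if "i \<in> {1..n}" for i
    unfolding mem[OF that] using assms(1) n by simp
  then show ?thesis using assms(2,3) n by blast
qed

lemma Sg_word_inject:
  assumes "p \<in> set_partitions" "q \<in> set_partitions"
  shows "Sg_word p = Sg_word q \<longleftrightarrow> ground_size p = ground_size q \<and> Sg p = Sg q"
  using bw_inject[OF _ Sg_subset[OF assms(1)] Sg_subset[OF assms(2)]] by (auto simp: Sg_word_def)

text \<open>Partitions live on 1-based and words on 0-based positions; reindexing by
  \<open>Suc\<close> lets both shuffles run over the same subsets.\<close>

lemma arc_shuffle_eq:
  "arc_shuffle t h =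
     image_mset (\<lambda>S. shift (Suc ` S) t \<union> shift (Suc ` ({..<ground_size t + ground_size h} - S)) h)
       (mset_set {S. S \<subseteq> {..<ground_size t + ground_size h} \<and> card S = ground_size t})"
proof -
  let ?n = "ground_size t" and ?N = "ground_size t + ground_size h"
  let ?P = "{S. S \<subseteq> {..<?N} \<and> card S = ?n}"
  have Suc_img: "Suc ` {..<?N} = {1..?N}"
    by (simp add: lessThan_atLeast0 atLeastLessThanSuc_atLeastAtMost)
  have "{S. S \<subseteq> {1..?N} \<and> card S = ?n} = image Suc ` ?P"
    unfolding Suc_img[symmetric] by (auto simp: subset_image_iff card_image)
  moreover have inj: "inj_on (image Suc) ?P"
    by (rule inj_onI) (simp add: inj_image_eq_iff)
  ultimately have "mset_set {S. S \<subseteq> {1..?N} \<and> card S = ?n} = image_mset (image Suc) (mset_set ?P)"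
    by (simp only: image_mset_mset_set)
  moreover have "{1..?N} - Suc ` S = Suc ` ({..<?N} - S)" for S
    unfolding Suc_img[symmetric] by (simp add: image_set_diff)
  ultimately show ?thesis
    by (simp only: arc_shuffle_def image_mset.compositionality o_def)
qed

lemma arc_shuffle_element:
  assumes t: "t \<in> set_partitions" and h: "h \<in> set_partitions"
    and S: "S \<subseteq> {..<ground_size t + ground_size h}" "card S = ground_size t"
  defines "p \<equiv> shift (Suc ` S) t \<union> shift (Suc ` ({..<ground_size t + ground_size h} - S)) h"
  shows "p \<in> set_partitions" "Sg_word p = interleave S (Sg_word t) (Sg_word h)"
proof -
  let ?N = "ground_size t + ground_size h"
  let ?S = "Suc ` S" and ?S' = "Suc ` ({..<?N} - S)"
  have "finite S" using S finite_subset by blast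
  then have fin: "finite ?S" "finite ?S'" by auto
  have cards: "card ?S = ground_size t" "card ?S' = ground_size h"
    using S \<open>finite S\<close> by (simp_all add: card_image card_Diff_subset)
  note parts = partition_on_shift[OF t fin(1) cards(1)] partition_on_shift[OF h fin(2) cards(2)]
  have union: "?S \<union> ?S' = {1..?N}"
  proof -
    have "?S \<union> ?S' = Suc ` {..<?N}" using S by auto
    then show ?thesis by (simp add: lessThan_atLeast0 atLeastLessThanSuc_atLeastAtMost)
  qed
  have disj: "?S \<inter> ?S' = {}" by auto
  have part: "partition_on {1..?N} p"
  proof (rule partition_onI)
    show "\<Union>p = {1..?N}"
      using parts[THEN partition_onD1] union by (simp add: p_def)
    show "{} \<notin> p"
      using parts[THEN partition_onD3] by (simp add: p_def)
    have cross: "disjnt C D" if "C \<in> shift ?S t" "D \<in> shift ?S' h" for C D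
      using that parts[THEN partition_onD1] disj by (auto simp: disjnt_def)
    fix C D assume "C \<in> p" "D \<in> p" "C \<noteq> D"
    then consider "C \<in> shift ?S t" "D \<in> shift ?S t" | "C \<in> shift ?S' h" "D \<in> shift ?S' h"
      | "C \<in> shift ?S t" "D \<in> shift ?S' h" | "C \<in> shift ?S' h" "D \<in> shift ?S t"
      unfolding p_def by blast
    then show "disjnt C D"
      by cases (use cross parts[THEN partition_onD2] \<open>C \<noteq> D\<close> in
        \<open>auto simp: pairwise_def disjnt_sym disjoint_def disjnt_def\<close>)
  qed
  then show p: "p \<in> set_partitions"
    by (auto simp: set_partitions_def)
  have size: "ground_size p = ?N"
    using partition_onD1[OF part] by (simp add: ground_size_def flip: \<open>{1..?N} = \<Union>p\<close>)
  \<comment> \<open>A block \<open>{Suc i}\<close> can only come from the part whose ground set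
    contains \<open>Suc i\<close>; there \<open>singleton_in_shift\<close> reduces the question to
    the rank.\<close>
  have Sg_left: "Suc i \<in> Sg p \<longleftrightarrow> Suc (card {j \<in> S. j < i}) \<in> Sg t" if "i \<in> S" for i
  proof -
    have "{j \<in> ?S. j < Suc i} = Suc ` {j \<in> S. j < i}" by auto
    then have "card {j \<in> ?S. j < Suc i} = card {j \<in> S. j < i}" by (simp add: card_image)
    moreover have "{Suc i} \<notin> shift ?S' h"
    proof
      assume "{Suc i} \<in> shift ?S' h"
      then have "Suc i \<in> ?S'" using partition_onD1[OF parts(2)] by blast
      then show False using that by auto
    qed
    ultimately show ?thesis
      using singleton_in_shift[OF t fin(1) cards(1), of "Suc i"] that by (simp add: Sg_def p_def)
  qed
  \<comment> \<open>\<open>interleave\<close> counts the complement of \<open>S\<close> among all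
    naturals, whereas \<open>?S'\<close> is bounded; for \<open>i < ?N\<close> the two counts
    agree.\<close>
  have Sg_right: "Suc i \<in> Sg p \<longleftrightarrow> Suc (card {j. j \<notin> S \<and> j < i}) \<in> Sg h" if "i \<notin> S" "i < ?N" for i
  proof -
    have "{j \<in> ?S'. j < Suc i} = Suc ` {j. j \<notin> S \<and> j < i}" using that by auto
    then have "card {j \<in> ?S'. j < Suc i} = card {j. j \<notin> S \<and> j < i}" by (simp add: card_image)
    moreover have "{Suc i} \<notin> shift ?S t"
    proof
      assume "{Suc i} \<in> shift ?S t"
      then have "Suc i \<in> ?S" using partition_onD1[OF parts(1)] by blast
      then show False using that by auto
    qed
    moreover have "Suc i \<in> ?S'" using that by auto
    ultimately show ?thesis
      using singleton_in_shift[OF h fin(2) cards(2), of "Suc i"] by (simp add: Sg_def p_def)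
  qed
  show "Sg_word p = interleave S (Sg_word t) (Sg_word h)"
  proof (rule nth_equalityI)
    show "length (Sg_word p) = length (interleave S (Sg_word t) (Sg_word h))"
      by (simp add: Sg_word_def size interleave_def)
    fix i assume "i < length (Sg_word p)"
    then have i: "i < ?N" by (simp add: Sg_word_def size)
    show "Sg_word p ! i = interleave S (Sg_word t) (Sg_word h) ! i"
    proof (cases "i \<in> S")
      case True
      \<comment> \<open>Strictness makes the rank a valid index into \<open>Sg_word t\<close>, as
        \<open>nth_bw\<close> demands.\<close>
      have "card {j \<in> S. j < i} < card S"
        by (rule psubset_card_mono) (use \<open>finite S\<close> True in auto)
      then show ?thesis
        using i True S by (simp add: Sg_word_def size interleave_def nth_bw Sg_left)
    next
      case False
      have "card {j. j \<notin> S \<and> j < i} < card ({..<?N} - S)"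
        by (rule psubset_card_mono) (use i False in auto)
      then have "card {j. j \<notin> S \<and> j < i} < ground_size h"
        using cards(2) by (simp add: card_image)
      then show ?thesis
        using i False by (simp add: Sg_word_def size interleave_def nth_bw Sg_right)
    qed
  qed
qed

lemma arc_shuffle_set_partitions:
  assumes "t \<in> set_partitions" "h \<in> set_partitions" "p \<in># arc_shuffle t h"
  shows "p \<in> set_partitions"
  using assms arc_shuffle_element(1)[OF assms(1,2)]
  by (auto simp: arc_shuffle_eq finite_subsets_card)

lemma image_mset_Sg_word_arc_shuffle:
  assumes "t \<in> set_partitions" "h \<in> set_partitions"
  shows "image_mset Sg_word (arc_shuffle t h) = word_shuffle (Sg_word t) (Sg_word h)"
proof -
  have len: "length (Sg_word p) = ground_size p" for p
    by (simp add: Sg_word_def)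
  show ?thesis
    unfolding arc_shuffle_eq word_shuffle_def len image_mset.compositionality o_def
    by (intro image_mset_cong arc_shuffle_element(2) assms) (simp_all add: finite_subsets_card)
qed

text \<open>The word depends only on the singleton set and the size, and so does the shuffle of two
  words. \<open>decode\<close> recovers the singleton set of each arc-shuffle from its word.\<close>

lemma weakly_shuffle_compatible_Sg: "weakly_shuffle_compatible Sg"
proof -
  define decode where "decode = (\<lambda>u :: nat list. {i \<in> {1..length u}. u ! (i - 1) = 1})"
  have decode: "decode (Sg_word p) = Sg p" if "p \<in> set_partitions" for p
  proof -
    have "Sg_word p ! (i - 1) = 1 \<longleftrightarrow> i \<in> Sg p" if "i \<in> {1..ground_size p}" for i
      using that unfolding Sg_word_def by (subst nth_bw) auto
    then have "decode (Sg_word p) = {i \<in> {1..ground_size p}. i \<in> Sg p}"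
      by (simp add: decode_def Sg_word_def cong: conj_cong)
    then show ?thesis using Sg_subset[OF that] by blast
  qed
  have "image_mset Sg (arc_shuffle t h) = image_mset decode (word_shuffle (Sg_word t) (Sg_word h))"
    if "t \<in> set_partitions" "h \<in> set_partitions" for t h
    unfolding image_mset_Sg_word_arc_shuffle[OF that, symmetric] image_mset.compositionality o_def
    by (rule image_mset_cong) (simp add: decode arc_shuffle_set_partitions[OF that])
  then show ?thesis
    unfolding weakly_shuffle_compatible_def by (metis Sg_word_inject)
qed

section \<open>Which words come from partitions\<close>

lemma sum_list_bw:
  assumes "T \<subseteq> {1..n}"
  shows "sum_list (bw n T) = card T"
proof -
  have "sum_list (bw n T) = (\<Sum>i\<in>{1..n}. if i \<in> T then 1 else 0)"
    unfolding bw_def interv_sum_list_conv_sum_set_nat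
    by (simp add: atLeastLessThanSuc_atLeastAtMost del: upt_Suc sum.op_ivl_Suc)
  also have "\<dots> = card ({1..n} \<inter> T)"
    by (simp add: sum.If_cases)
  also have "{1..n} \<inter> T = T" using assms by auto
  finally show ?thesis .
qed

lemma set_bw: "set (bw n T) \<subseteq> {0, 1}"
  by (auto simp: bw_def)

text \<open>If all but one element were singletons, the remaining element would have nothing to share
  its block with.\<close>

lemma card_Sg_neq:
  assumes p: "p \<in> set_partitions"
  shows "Suc (card (Sg p)) \<noteq> ground_size p"
proof
  assume eq: "Suc (card (Sg p)) = ground_size p"
  let ?G = "{1..ground_size p}"
  note part = set_partitions_partition_on[OF p]
  have "card (?G - Sg p) = 1"
    using eq Sg_subset[OF p] by (simp add: card_Diff_subset finite_subset[OF Sg_subset[OF p]])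
  then obtain x where x: "?G - Sg p = {x}" by (rule card_1_singletonE)
  then obtain C where C: "C \<in> p" "x \<in> C"
    using part(2) by blast
  have "C \<noteq> {x}" using C x by (auto simp: Sg_def)
  then obtain y where y: "y \<in> C" "y \<noteq> x" using C by blast
  then have "y \<in> ?G" using C part(2) by blast
  then have "y \<in> Sg p" using x y(2) by blast
  then have "{y} \<in> p" by (simp add: Sg_def)
  then have "C = {y}"
    using C(1) y(1) partition_onD2[OF part(1)] by (fastforce simp: disjoint_def)
  then show False using C(2) y(2) by blast
qed

lemma image_Sg_word:
  "Sg_word ` set_partitions =
     {u \<in> binary_words. int (sum_list u) \<noteq> int (length u) - 1}"
proof (intro equalityI subsetI)
  fix u assume "u \<in> Sg_word ` set_partitions"
  then obtain p where p: "p \<in> set_partitions" "u = bw (ground_size p) (Sg p)"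
    by (auto simp: Sg_word_def)
  then show "u \<in> {u \<in> binary_words. int (sum_list u) \<noteq> int (length u) - 1}"
    using card_Sg_neq[OF p(1)] set_bw
    by (auto simp: binary_words_def sum_list_bw[OF Sg_subset[OF p(1)]] lists_eq_set)
next
  fix u assume u: "u \<in> {u \<in> binary_words. int (sum_list u) \<noteq> int (length u) - 1}"
  define n where "n = length u"
  define T where "T = {i \<in> {1..n}. u ! (i - 1) = 1}"
  define Z where "Z = {1..n} - T"
  \<comment> \<open>All zeros are put into one block \<open>Z\<close>, dropped if there are none. It
    would add an unwanted singleton only if \<open>u\<close> had exactly one zero, which is
    excluded.\<close>
  define p where "p = (\<lambda>i. {i}) ` T \<union> ({Z} - {{}})"
  have "u = bw n T"
  proof (rule nth_equalityI)
    fix i assume i: "i < length u"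
    then have "u ! i \<in> {0, 1}"
      using u nth_mem[OF i] by (auto simp: binary_words_def)
    then show "u ! i = bw n T ! i"
      using i by (auto simp: nth_bw n_def T_def)
  qed (simp add: n_def)
  have T: "T \<subseteq> {1..n}" by (auto simp: T_def)
  have "partition_on {1..n} p"
    using T by (intro partition_onI) (auto simp: p_def Z_def disjnt_def)
  then have p: "p \<in> set_partitions" and size: "ground_size p = n"
    using partition_onD1[of "{1..n}" p, symmetric]
    by (auto simp: set_partitions_def ground_size_def)
  have "int (card T) \<noteq> int n - 1"
    using u sum_list_bw[OF T] \<open>u = bw n T\<close> by simp
  moreover have "card Z = n - card T" "card T \<le> n"
    using T card_mono[OF _ T] by (simp_all add: Z_def card_Diff_subset finite_subset)
  ultimately have "card Z \<noteq> 1" by auto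
  then have "{x} \<noteq> Z" for x by auto
  then have "Sg p = T"
    by (auto simp: Sg_def p_def)
  then have "Sg_word p = u"
    using size \<open>u = bw n T\<close> by (simp add: Sg_word_def)
  then show "u \<in> Sg_word ` set_partitions" using p by blast
qed

section \<open>The algebra of the classes of singleton sets\<close>

text \<open>The representative is chosen by the same term as in \<open>class_shuffle\<close>, so the
  product of two classes and the shuffle of their words refer to the same partitions.\<close>

definition class_word :: "nat set set set \<Rightarrow> nat list" where
  "class_word K = Sg_word (SOME t. t \<in> K)"

lemma some_in_st_class:
  assumes "p \<in> set_partitions"
  shows "(SOME t. t \<in> st_class st p) \<in> st_class st p"
  by (rule someI[of _ p]) (use assms in \<open>simp add: st_class_def\<close>)

lemma class_word_st_class:
  assumes "p \<in> set_partitions"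
  shows "class_word (st_class Sg p) = Sg_word p"
  using some_in_st_class[OF assms, of Sg] by (simp add: class_word_def Sg_word_def st_class_def)

lemma empty_set_partitions: "{} \<in> set_partitions"
  unfolding set_partitions_def by (intro CollectI exI[of _ 0]) (simp add: partition_on_empty)

lemma Sg_word_empty: "Sg_word {} = []"
  by (simp add: Sg_word_def ground_size_def bw_def)

interpretation words: multiplication_table binary_words word_shuffle "[]"
proof
  show "set_mset (word_shuffle v w) \<subseteq> binary_words"
    if "v \<in> binary_words" "w \<in> binary_words" for v w
  proof
    fix u assume "u \<in># word_shuffle v w"
    then have "set_mset (mset u) = set_mset (mset v + mset w)"
      by (simp only: mset_word_shuffle)
    then show "u \<in> binary_words"
      using that by (auto simp: binary_words_def lists_eq_set)
  qed
  show "[] \<in> binary_words" by (simp add: binary_words_def)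
qed (rule word_shuffle_commute word_shuffle_assoc word_shuffle_Nil_left)+

interpretation classes: table_embedding binary_words word_shuffle "[]"
  "st_class Sg ` set_partitions" "class_shuffle Sg" "st_class Sg {}" class_word
proof unfold_locales
  show "inj_on class_word (st_class Sg ` set_partitions)"
  proof (rule inj_onI)
    fix K L assume "K \<in> st_class Sg ` set_partitions" "L \<in> st_class Sg ` set_partitions"
      and eq: "class_word K = class_word L"
    then obtain p q where p: "p \<in> set_partitions" "K = st_class Sg p"
      and q: "q \<in> set_partitions" "L = st_class Sg q" by blast
    have "ground_size p = ground_size q \<and> Sg p = Sg q"
      using eq unfolding p(2) q(2) class_word_st_class[OF p(1)] class_word_st_class[OF q(1)]
        Sg_word_inject[OF p(1) q(1)] .
    then show "K = L" by (simp add: p(2) q(2) st_class_def)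
  qed
  show "class_word K \<in> binary_words" if "K \<in> st_class Sg ` set_partitions" for K
    using that image_Sg_word by (auto simp: class_word_st_class)
  show "st_class Sg {} \<in> st_class Sg ` set_partitions"
    using empty_set_partitions by blast
  show "class_word (st_class Sg {}) = []"
    by (simp add: class_word_st_class empty_set_partitions Sg_word_empty)
  fix K L assume "K \<in> st_class Sg ` set_partitions" "L \<in> st_class Sg ` set_partitions"
  then obtain p q where p: "p \<in> set_partitions" "K = st_class Sg p"
    and q: "q \<in> set_partitions" "L = st_class Sg q" by blast
  \<comment> \<open>The representatives used by the product; they lie in the classes of
    \<open>p\<close> and \<open>q\<close> but may differ from them.\<close>
  define t h where "t = (SOME t. t \<in> K)" and "h = (SOME h. h \<in> L)"
  have t: "t \<in> set_partitions" and h: "h \<in> set_partitions"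
    using some_in_st_class[OF p(1), of Sg] some_in_st_class[OF q(1), of Sg]
    by (simp_all add: t_def h_def p q st_class_def)
  have shuffle: "class_shuffle Sg K L = image_mset (st_class Sg) (arc_shuffle t h)"
    by (simp add: class_shuffle_def t_def h_def)
  show "set_mset (class_shuffle Sg K L) \<subseteq> st_class Sg ` set_partitions"
    unfolding shuffle using arc_shuffle_set_partitions[OF t h] by auto
  have "image_mset class_word (class_shuffle Sg K L) = image_mset Sg_word (arc_shuffle t h)"
    unfolding shuffle image_mset.compositionality o_def
    by (rule image_mset_cong) (simp add: class_word_st_class arc_shuffle_set_partitions[OF t h])
  also have "\<dots> = word_shuffle (class_word K) (class_word L)"
    using image_mset_Sg_word_arc_shuffle[OF t h] by (simp add: class_word_def t_def h_def)
  finally show "image_mset class_word (class_shuffle Sg K L) =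
      word_shuffle (class_word K) (class_word L)" .
qed

lemma class_word_image: "class_word ` st_class Sg ` set_partitions = Sg_word ` set_partitions"
  unfolding image_image by (rule image_cong) (simp_all add: class_word_st_class)

text \<open>This brings the span into the form of the restricted carrier for which
  \<open>classes.linear_map_is_iso\<close> is stated.\<close>

lemma Sg_span_eq:
  "Sg_span = {f. Poly_Mapping.keys f \<subseteq> class_word ` st_class Sg ` set_partitions}"
  unfolding Sg_span_def class_word_image image_Sg_word span_basis_vec[symmetric] by simp

text \<open>A linear map is fixed by its values on classes only within the carrier, so the
  isomorphism claim is made for every such function; the existence clause keeps that claim from
  being vacuous.\<close>

theorem theorem5p6:
  shows "weakly_shuffle_compatible Sg \<and>
    algebra rat_field (class_algebra Sg) \<and>
    algebra rat_field shuffle_algebra \<and>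
    submodule Sg_span rat_field shuffle_algebra \<and>
    subring Sg_span shuffle_algebra \<and>
    (\<exists>\<Phi>\<in>linear_maps rat_field (class_algebra Sg) shuffle_algebra.
       \<forall>p\<in>set_partitions. \<Phi> (basis_vec (st_class Sg p)) = basis_vec (bw (ground_size p) (Sg p))) \<and>
    (\<forall>\<Phi>\<in>linear_maps rat_field (class_algebra Sg) shuffle_algebra.
       (\<forall>p\<in>set_partitions. \<Phi> (basis_vec (st_class Sg p)) = basis_vec (bw (ground_size p) (Sg p)))
       \<longrightarrow> \<Phi> \<in> algebra_isos rat_field (class_algebra Sg)
                 (shuffle_algebra\<lparr>carrier := Sg_span\<rparr>))"
proof (intro conjI)
  have image_sub: "class_word ` st_class Sg ` set_partitions \<subseteq> binary_words"
    using classes.into by blast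
  show "weakly_shuffle_compatible Sg"
    by (rule weakly_shuffle_compatible_Sg)
  show "algebra rat_field (class_algebra Sg)"
    unfolding class_algebra_def
    by (rule multiplication_table.algebra_table_algebra[OF classes.multiplication_table])
  show "algebra rat_field shuffle_algebra"
    unfolding shuffle_algebra_def by (rule words.algebra_table_algebra)
  show "submodule Sg_span rat_field shuffle_algebra"
    unfolding shuffle_algebra_def Sg_span_eq by (rule words.submodule_subset[OF image_sub])
  show "subring Sg_span shuffle_algebra"
    unfolding shuffle_algebra_def Sg_span_eq
  \<comment> \<open>Closure under shuffling is inherited from the classes through
    \<open>classes.image_table_closed\<close>.\<close>
  proof (rule words.subring_subset[OF image_sub _ classes.image_table_closed])
    show "[] \<in> class_word ` st_class Sg ` set_partitions"
      using classes.table_unit by (metis image_eqI)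
  qed
  show "\<exists>\<Phi>\<in>linear_maps rat_field (class_algebra Sg) shuffle_algebra.
      \<forall>p\<in>set_partitions. \<Phi> (basis_vec (st_class Sg p)) = basis_vec (bw (ground_size p) (Sg p))"
    unfolding class_algebra_def shuffle_algebra_def
    by (rule bexI[OF _ classes.linear_extension_in_linear_maps])
      (simp add: class_word_st_class Sg_word_def)
  show "\<forall>\<Phi>\<in>linear_maps rat_field (class_algebra Sg) shuffle_algebra.
      (\<forall>p\<in>set_partitions. \<Phi> (basis_vec (st_class Sg p)) = basis_vec (bw (ground_size p) (Sg p)))
      \<longrightarrow> \<Phi> \<in> algebra_isos rat_field (class_algebra Sg) (shuffle_algebra\<lparr>carrier := Sg_span\<rparr>)"
    unfolding class_algebra_def shuffle_algebra_def Sg_span_eq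
    by (intro ballI impI classes.linear_map_is_iso) (auto simp: class_word_st_class Sg_word_def)
qed

end
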